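(* Let $c$ be a real number larger than $1$, and let $\varphi$ denote Euler's totient function. Then the sequence $$\left(\sum_{m\le n}\frac{\varphi(\lfloor m^c\rfloor)}{\lfloor m^c\rfloor}\right)_{n\ge 1}$$ is dense modulo $1$, i.e. the set of fractional parts of its terms is dense in $[0,1]$.
   Context: $\lfloor u\rfloor$ denotes the integer part of a real number $u$. *)

theory Defs
  imports "HOL-Analysis.Analysis" "HOL-Number_Theory.Totient"
begin

definition totient_ratio_sum :: "real \<Rightarrow> nat \<Rightarrow> real" where
  "totient_ratio_sum c n =
     (\<Sum>m = 1..n. real (totient (nat \<lfloor>real m powr c\<rfloor>)) / real_of_int \<lfloor>real m powr c\<rfloor>)"

definition dense_mod_1 :: "(nat \<Rightarrow> real) \<Rightarrow> bool" where
  "dense_mod_1 x \<longleftrightarrow> closure {frac (x n) | n. n \<ge> 1} = {0..1}"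

end

theory Submission
  imports Defs "HOL-Real_Asymp.Real_Asymp"
begin

text \<open>
  It suffices to find, for every \<open>\<epsilon> > 0\<close>, a block of consecutive indices \<open>m\<close> on which
  \<open>\<phi>(N)/N\<close> with \<open>N = \<lfloor>m\<^sup>c\<rfloor>\<close> is at most \<open>\<epsilon>\<close> but sums up to at least \<open>1\<close>.

  If \<open>c\<close> is not an integer, fix \<open>q\<close> with \<open>\<phi>(q)/q < \<epsilon>\<close> and let \<open>r = \<lfloor>c\<rfloor>\<close>. The \<open>r\<close>-th forward
  difference of \<open>m\<^sup>c/q\<close> tends to infinity, but so slowly that modulo 1 it stays in a tiny interval
  to the right of \<open>0\<close> for a long time. Meanwhile the difference of order \<open>r - 1\<close> moves modulo 1
  by tiny positive steps, so it too enters a (larger) tiny interval and stays there; descending to order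
  \<open>0\<close> gives a block around \<open>M\<close>, longer than any given multiple of \<open>log M\<close>, on which the fractional
  part of \<open>m\<^sup>c/q\<close> is below \<open>1/q\<close>, that is, \<open>q\<close> divides \<open>\<lfloor>m\<^sup>c\<rfloor>\<close>. The trivial bound
  \<open>\<phi>(N)/N \<ge> 1/(1 + log\<^sub>2 N)\<close> then makes the sum at least \<open>1\<close>.

  If \<open>c\<close> is an integer, then \<open>\<phi>(m\<^sup>c)/m\<^sup>c = \<phi>(m)/m\<close>. Choose \<open>K\<close> disjoint sets of primes above \<open>K\<close>, each
  with Euler product between \<open>\<epsilon>/2\<close> and \<open>\<epsilon>\<close>. By the Chinese remainder theorem there is an arithmetic
  progression of \<open>a\<close> such that the primes of the \<open>j\<close>-th set divide \<open>a + j\<close> for all \<open>j \<le> K\<close>. On average over the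
  progression the remaining prime factors \<open>p\<close> of \<open>a + j\<close> satisfy \<open>\<Sum>1/p \<le> 2\<close>, hence for some \<open>a\<close>
  the block has sum at least \<open>K \<epsilon> e\<^sup>-\<^sup>4 / 2\<close>.
\<close>

section \<open>Small steps modulo 1\<close>

lemma ex_between_if_small_steps:
  fixes h :: "nat \<Rightarrow> 'a :: linordered_ab_group_add"
  assumes "a \<le> b" "h a \<le> t" "t \<le> h b" "0 \<le> \<epsilon>"
    and step: "\<And>n. n \<in> {a..<b} \<Longrightarrow> h (Suc n) \<le> h n + \<epsilon>"
  shows "\<exists>n\<in>{a..b}. h n \<in> {t..t + \<epsilon>}"
proof -
  define n where "n = (LEAST n. a \<le> n \<and> t \<le> h n)"
  have n: "a \<le> n \<and> t \<le> h n"
    unfolding n_def by (rule LeastI[of _ b]) (use assms in simp)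
  have "n \<le> b"
    unfolding n_def by (rule Least_le) (use assms in simp)
  have "h n \<le> t + \<epsilon>"
  proof (cases "n = a")
    case True
    then show ?thesis using \<open>h a \<le> t\<close> \<open>0 \<le> \<epsilon>\<close> by (simp add: add_increasing2)
  next
    case False
    then obtain k where k: "n = Suc k" "a \<le> k"
      using n by (cases n) auto
    then have "h k < t"
      using not_less_Least[of k "\<lambda>n. a \<le> n \<and> t \<le> h n"] unfolding n_def by auto
    then show ?thesis
      using step[of k] k \<open>n \<le> b\<close> by (auto intro: order_trans add_right_mono)
  qed
  then show ?thesis using n \<open>n \<le> b\<close> by auto
qed

lemma ex_between_mod_1_if_small_steps:
  fixes h :: "nat \<Rightarrow> real"
  assumes "a \<le> b" "h a + 1 \<le> h b" "0 \<le> \<epsilon>" "\<And>n. n \<in> {a..<b} \<Longrightarrow> h (Suc n) \<le> h n + \<epsilon>"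
  shows "\<exists>n\<in>{a..b}. \<exists>k. h n \<in> {of_int k + y..of_int k + y + \<epsilon>}"
proof -
  have "h a \<le> of_int \<lceil>h a - y\<rceil> + y" "of_int \<lceil>h a - y\<rceil> + y \<le> h b"
    using assms(2) by linarith+
  then show ?thesis
    using ex_between_if_small_steps[of a b h] assms by blast
qed

lemma frac_in_atLeastAtMost:
  fixes u :: real
  assumes "u \<in> {of_int k + \<alpha>..of_int k + \<beta>}" "0 \<le> \<alpha>" "\<beta> < 1"
  shows "frac u \<in> {\<alpha>..\<beta>}"
proof -
  have "frac u = u - of_int k"
    using assms by (subst frac_unique_iff) auto
  then show ?thesis
    using assms(1) by auto
qed

lemma dense_mod_1I:
  assumes "\<And>y \<delta>. y \<in> {0<..<1} \<Longrightarrow> \<delta> > 0 \<Longrightarrow> \<exists>n\<ge>1. \<bar>frac (x n) - y\<bar> < \<delta>"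
  shows "dense_mod_1 x"
proof -
  let ?S = "{frac (x n) | n. n \<ge> 1}"
  have "closure ?S \<subseteq> {0..1}"
    by (intro closure_minimal) (auto simp: frac_lt_1 less_imp_le)
  moreover have "{0<..<1} \<subseteq> closure ?S"
  proof
    fix y :: real assume "y \<in> {0<..<1}"
    then show "y \<in> closure ?S"
      using assms[of y] unfolding closure_approachable dist_real_def by fastforce
  qed
  then have "closure {0<..<1::real} \<subseteq> closure ?S"
    by (rule closure_minimal) simp
  ultimately show ?thesis
    unfolding dense_mod_1_def by auto
qed

definition has_heavy_block :: "(nat \<Rightarrow> real) \<Rightarrow> real \<Rightarrow> bool" where
  "has_heavy_block w \<epsilon> \<longleftrightarrow>
     (\<exists>a K. (\<forall>j\<in>{1..K}. w (a + j) \<le> \<epsilon>) \<and> 1 \<le> (\<Sum>j = 1..K. w (a + j)))"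

lemma has_heavy_block_if_ge_inverse:
  assumes "K > 0" "\<And>j. j \<in> {1..K} \<Longrightarrow> w (a + j) \<in> {1 / real K..\<epsilon>}"
  shows "has_heavy_block w \<epsilon>"
proof -
  have "(\<Sum>j = 1..K. 1 / real K) \<le> (\<Sum>j = 1..K. w (a + j))"
    using assms(2) by (intro sum_mono) auto
  then have "1 \<le> (\<Sum>j = 1..K. w (a + j))"
    using \<open>K > 0\<close> by simp
  then show ?thesis
    using assms(2) unfolding has_heavy_block_def by (intro exI[of _ a] exI[of _ K]) auto
qed

lemma dense_mod_1_sum_if_heavy_blocks:
  assumes heavy: "\<And>\<epsilon>. 0 < \<epsilon> \<Longrightarrow> \<epsilon> \<le> 1 \<Longrightarrow> has_heavy_block w \<epsilon>"
  shows "dense_mod_1 (\<lambda>n. \<Sum>m = 1..n. w m)"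
proof (rule dense_mod_1I)
  fix y \<delta> :: real
  assume y: "y \<in> {0<..<1}" and "\<delta> > 0"
  define s where "s n = (\<Sum>m = 1..n. w m)" for n
  define \<epsilon> where "\<epsilon> = min \<delta> (1 - y) / 2"
  have \<epsilon>: "0 < \<epsilon>" "\<epsilon> \<le> 1" "\<epsilon> < \<delta>" "y + \<epsilon> < 1"
    using y \<open>\<delta> > 0\<close> by (auto simp: \<epsilon>_def min_def field_simps)
  obtain a K where small: "\<And>j. j \<in> {1..K} \<Longrightarrow> w (a + j) \<le> \<epsilon>"
    and sum: "1 \<le> (\<Sum>j = 1..K. w (a + j))"
    using heavy[OF \<epsilon>(1,2)] unfolding has_heavy_block_def by blast
  have "s (a + K) = s a + (\<Sum>j = 1..K. w (a + j))"
    by (induction K) (simp_all add: s_def)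
  moreover have "s (Suc n) \<le> s n + \<epsilon>" if "n \<in> {a..<a + K}" for n
  proof -
    have "Suc n - a \<in> {1..K}"
      using that by auto
    then show ?thesis
      using small[of "Suc n - a"] that by (simp add: s_def)
  qed
  ultimately obtain n k where "s n \<in> {of_int k + y..of_int k + y + \<epsilon>}"
    using ex_between_mod_1_if_small_steps[of a "a + K" s \<epsilon> y] sum \<epsilon> by auto
  then have "frac (s n) \<in> {y..y + \<epsilon>}"
    using y \<epsilon> by (intro frac_in_atLeastAtMost[of _ k]) (auto simp: add_ac)
  moreover from this have "n \<noteq> 0"
    using y by (intro notI) (simp add: s_def)
  ultimately show "\<exists>n\<ge>1. \<bar>frac (\<Sum>m = 1..n. w m) - y\<bar> < \<delta>"
    using \<epsilon> by (intro exI[of _ n]) (auto simp: s_def)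
qed

section \<open>Euler products and the totient ratio\<close>

definition euler_prod :: "nat set \<Rightarrow> real" where
  "euler_prod A = (\<Prod>p\<in>A. 1 - 1 / real p)"

definition totient_ratio :: "nat \<Rightarrow> real" where
  "totient_ratio n = real (totient n) / real n"

lemma euler_prod_Un_disjoint:
  "finite A \<Longrightarrow> finite B \<Longrightarrow> A \<inter> B = {} \<Longrightarrow> euler_prod (A \<union> B) = euler_prod A * euler_prod B"
  unfolding euler_prod_def by (rule prod.union_disjoint)

lemma euler_prod_pos: "A \<subseteq> {2..} \<Longrightarrow> 0 < euler_prod A"
  unfolding euler_prod_def by (rule prod_pos) force

lemma euler_prod_le_1: "A \<subseteq> {2..} \<Longrightarrow> euler_prod A \<le> 1"
  unfolding euler_prod_def by (rule prod_le_1) force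

lemma euler_prod_antimono:
  assumes "finite B" "A \<subseteq> B" "B \<subseteq> {2..}"
  shows "euler_prod B \<le> euler_prod A"
proof -
  have "euler_prod (A \<union> (B - A)) = euler_prod A * euler_prod (B - A)"
    using assms by (intro euler_prod_Un_disjoint) (auto intro: finite_subset)
  moreover have "A \<union> (B - A) = B" "A \<subseteq> {2..}" "B - A \<subseteq> {2..}"
    using assms by auto
  ultimately show ?thesis
    using euler_prod_pos[of A] euler_prod_le_1[of "B - A"] by (simp add: mult_le_cancel_left1)
qed

lemma euler_prod_ge_card:
  assumes "finite A" "A \<subseteq> {2..}"
  shows "1 / (real (card A) + 1) \<le> euler_prod A"
  using assms
proof (induction A rule: finite_linorder_max_induct)
  case empty
  then show ?case by (simp add: euler_prod_def)
next
  case (insert b A)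
  then have "b \<ge> 2" "A \<subseteq> {2..<b}"
    by auto
  then have "card A + 2 \<le> b"
    using card_mono[of "{2..<b}" A] by simp
  then have b: "real (card A) + 2 \<le> real b"
    by linarith
  have "1 / (real (card A) + 2) = (1 - 1 / (real (card A) + 2)) * (1 / (real (card A) + 1))"
    by (simp add: field_simps)
  also have "\<dots> \<le> (1 - 1 / real b) * euler_prod A"
    using insert b by (intro mult_mono diff_mono divide_left_mono) auto
  also have "\<dots> = euler_prod (insert b A)"
    using insert.hyps by (subst (2) euler_prod_def, subst prod.insert) (auto simp: euler_prod_def)
  also have "real (card A) + 2 = real (card (insert b A)) + 1"
    using insert.hyps by (subst card_insert_disjoint) auto
  finally show ?case .
qed

lemma euler_prod_ge_exp:
  assumes "finite A" "A \<subseteq> {2..}"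
  shows "exp (- 2 * (\<Sum>p\<in>A. 1 / real p)) \<le> euler_prod A"
proof -
  have exp_le: "exp (- 2 * x) \<le> 1 - x" if "x \<in> {0..1 / 2}" for x :: real
  proof -
    have "x * x \<le> 1 / 2 * x"
      using that by (intro mult_right_mono) auto
    then have "- 2 * x \<le> ln (1 - x)"
      using ln_one_minus_pos_lower_bound[of x] that by (simp add: power2_eq_square)
    then show ?thesis
      using that by (simp add: ln_ge_iff)
  qed
  have "exp (- 2 * (\<Sum>p\<in>A. 1 / real p)) = (\<Prod>p\<in>A. exp (- 2 * (1 / real p)))"
    using assms by (simp add: sum_distrib_left exp_sum)
  also have "\<dots> \<le> euler_prod A"
    unfolding euler_prod_def using assms
    by (intro prod_mono conjI exp_le) (force simp: field_simps)+
  finally show ?thesis .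
qed

lemma prime_factors_subset_atLeast_2: "prime_factors n \<subseteq> {2 :: nat..}"
  by (auto simp: in_prime_factors_iff prime_ge_2_nat)

lemma totient_ratio_eq_euler_prod: "n > 0 \<Longrightarrow> totient_ratio n = euler_prod (prime_factors n)"
  unfolding totient_ratio_def euler_prod_def using totient_formula2[of n] by simp

lemma totient_ratio_power: "k > 0 \<Longrightarrow> totient_ratio (n ^ k) = totient_ratio n"
  by (cases "n = 0") (simp_all add: totient_ratio_eq_euler_prod prime_factors_power zero_power)

lemma totient_ratio_dvd_mono:
  assumes "a dvd b" "b > 0"
  shows "totient_ratio b \<le> totient_ratio a"
proof -
  have "a > 0"
    using assms by (auto intro: Nat.gr0I)
  then show ?thesis
    using assms prime_factors_subset_atLeast_2[of b]
    by (simp add: totient_ratio_eq_euler_prod dvd_prime_factors euler_prod_antimono)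
qed

lemma two_power_card_prime_factors_le: "n > 0 \<Longrightarrow> 2 ^ card (prime_factors n) \<le> (n :: nat)"
proof -
  assume "n > 0"
  have "2 ^ card (prime_factors n) = (\<Prod>p\<in>prime_factors n. 2 :: nat)"
    by simp
  also have "\<dots> \<le> (\<Prod>p\<in>prime_factors n. p ^ multiplicity p n)"
  proof (intro prod_mono conjI)
    fix p assume "p \<in> prime_factors n"
    then have "2 \<le> p" "0 < multiplicity p n"
      by (auto simp: prime_factors_multiplicity prime_ge_2_nat)
    then show "2 \<le> p ^ multiplicity p n"
      using self_le_power[of p "multiplicity p n"] by simp
  qed simp
  also have "\<dots> = n"
    using \<open>n > 0\<close> by (metis prime_factorization_nat)
  finally show ?thesis .
qed

lemma totient_ratio_ge_log:
  assumes "n > 0"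
  shows "1 / (log 2 (real n) + 1) \<le> totient_ratio n"
proof -
  have "real (card (prime_factors n)) \<le> log 2 (real n)"
    using two_power_card_prime_factors_le[OF assms] assms by (simp add: le_log_of_power)
  then have "1 / (log 2 (real n) + 1) \<le> 1 / (real (card (prime_factors n)) + 1)"
    by (intro divide_left_mono) auto
  also have "\<dots> \<le> totient_ratio n"
    unfolding totient_ratio_eq_euler_prod[OF assms]
    by (intro euler_prod_ge_card prime_factors_subset_atLeast_2) simp
  finally show ?thesis .
qed

lemma totient_ratio_mult_sum_inverse_divisors_le_1:
  assumes "n > 0"
  shows "totient_ratio n * (\<Sum>d | d dvd n. 1 / real d) \<le> 1"
proof -
  have "real n * (totient_ratio n * (\<Sum>d | d dvd n. 1 / real d))
      = (\<Sum>d | d dvd n. totient_ratio n * real (n div d))"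
    unfolding sum_distrib_left by (intro sum.cong) (auto simp: real_of_nat_div)
  also have "\<dots> \<le> (\<Sum>d | d dvd n. real (totient (n div d)))"
  proof (rule sum_mono)
    fix d assume "d \<in> {d. d dvd n}"
    then have "n div d > 0" "n div d dvd n"
      using assms by (auto simp: dvd_div_eq_0_iff)
    then have "totient_ratio n * real (n div d) \<le> totient_ratio (n div d) * real (n div d)"
      using assms by (intro mult_right_mono totient_ratio_dvd_mono) auto
    then show "totient_ratio n * real (n div d) \<le> real (totient (n div d))"
      using \<open>n div d > 0\<close> by (simp add: totient_ratio_def)
  qed
  also have "\<dots> = real (\<Sum>d | d dvd n. totient d)"
    using assms unfolding of_nat_sum
    by (intro sum.reindex_bij_witness[of _ "\<lambda>d. n div d" "\<lambda>d. n div d"]) auto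
  also have "\<dots> = real n * 1"
    by (simp add: totient_divisor_sum)
  finally show ?thesis
    using assms by simp
qed

lemma ex_totient_ratio_less:
  assumes "\<epsilon> > 0"
  shows "\<exists>n>0. totient_ratio n < \<epsilon>"
proof -
  have "\<forall>\<^sub>F n in sequentially. harm n > 1 / \<epsilon>"
    using harm_at_top by (simp add: filterlim_at_top_dense)
  then obtain n where "harm n > 1 / \<epsilon>"
    by (auto simp: eventually_sequentially)
  also have "harm n = (\<Sum>d\<in>{1..n}. 1 / real d)"
    by (simp add: harm_def inverse_eq_divide)
  also have "\<dots> \<le> (\<Sum>d | d dvd fact n. 1 / real d)"
    by (intro sum_mono2) (auto simp: dvd_fact)
  finally have "totient_ratio (fact n) * (1 / \<epsilon>)
      < totient_ratio (fact n) * (\<Sum>d | d dvd fact n. 1 / real d)"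
    by (intro mult_strict_left_mono) (auto simp: totient_ratio_def)
  also have "\<dots> \<le> 1"
    by (intro totient_ratio_mult_sum_inverse_divisors_le_1) simp
  finally show ?thesis
    using assms by (intro exI[of _ "fact n"]) (simp add: field_simps)
qed

section \<open>Non-integer exponents\<close>

definition fwd_diff :: "('a :: {plus, one} \<Rightarrow> 'b :: minus) \<Rightarrow> 'a \<Rightarrow> 'b" where
  "fwd_diff f x = f (x + 1) - f x"

lemma fwd_diff_funpow_of_nat:
  "(fwd_diff ^^ n) (\<lambda>m. f (of_nat m)) m = (fwd_diff ^^ n) f (of_nat m :: 'a :: semiring_1)"
  by (induction n arbitrary: m) (simp_all add: fwd_diff_def add.commute)

lemma fwd_diff_bounds_increment:
  fixes h :: "nat \<Rightarrow> real"
  assumes "\<And>i. i < j \<Longrightarrow> fwd_diff h (a + i) \<in> {\<alpha>..\<beta>}"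
  shows "h (a + j) - h a \<in> {real j * \<alpha>..real j * \<beta>}"
proof -
  have "h (a + j) - h a = (\<Sum>i<j. fwd_diff h (a + i))"
    using sum_lessThan_telescope[of "\<lambda>i. h (a + i)" j] by (simp add: fwd_diff_def)
  then show ?thesis
    using sum_bounded_below[of "{..<j}" \<alpha> "\<lambda>i. fwd_diff h (a + i)"]
      sum_bounded_above[of "{..<j}" "\<lambda>i. fwd_diff h (a + i)" \<beta>] assms by auto
qed

text \<open>The lower end of the band forces a sequence whose differences lie in it to climb by \<open>1\<close>.\<close>

definition frac_in_band :: "real \<Rightarrow> (nat \<Rightarrow> real) \<Rightarrow> nat set \<Rightarrow> bool" where
  "frac_in_band \<delta> h A \<longleftrightarrow> (\<forall>m\<in>A. frac (h m) \<in> {\<delta> / 2..\<delta>})"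

lemma frac_in_band_subset: "frac_in_band \<delta> h B \<Longrightarrow> A \<subseteq> B \<Longrightarrow> frac_in_band \<delta> h A"
  unfolding frac_in_band_def by blast

lemma ex_frac_in_band_if_slow_increase:
  fixes h :: "nat \<Rightarrow> real"
  assumes "a \<le> b" "h a + 1 \<le> h b" "0 < \<delta>" "\<delta> < 1"
    and \<eta>: "0 \<le> \<eta>" "(real N + 1) * \<eta> \<le> \<delta> / 2"
    and slow: "\<And>m. m \<in> {a..<b + N} \<Longrightarrow> fwd_diff h m \<in> {0..\<eta>}"
  shows "\<exists>n\<in>{a..b}. frac_in_band \<delta> h {n..n + N}"
proof -
  have "h (Suc m) \<le> h m + \<eta>" if "m \<in> {a..<b}" for m
    using slow[of m] that by (simp add: fwd_diff_def)
  then obtain n k where n: "n \<in> {a..b}"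
    and h_n: "h n \<in> {of_int k + \<delta> / 2..of_int k + \<delta> / 2 + \<eta>}"
    using ex_between_mod_1_if_small_steps[of a b h \<eta> "\<delta> / 2"] assms(1,2) \<eta>(1) by blast
  have "frac (h m) \<in> {\<delta> / 2..\<delta>}" if "m \<in> {n..n + N}" for m
  proof -
    obtain j where j: "m = n + j" "j \<le> N"
      using \<open>m \<in> {n..n + N}\<close> by (metis add_le_cancel_left atLeastAtMost_iff le_Suc_ex)
    have "h m - h n \<in> {real j * 0..real j * \<eta>}"
      unfolding j using n j by (intro fwd_diff_bounds_increment slow) auto
    moreover have "real j * \<eta> \<le> real N * \<eta>"
      using j \<eta>(1) by (intro mult_right_mono) auto
    ultimately have "h m \<in> {of_int k + \<delta> / 2..of_int k + \<delta>}"
      using h_n \<eta>(2) by (auto simp: algebra_simps)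
    then show ?thesis
      using \<open>0 < \<delta>\<close> \<open>\<delta> < 1\<close> by (intro frac_in_atLeastAtMost[of _ k]) auto
  qed
  then show ?thesis
    using n unfolding frac_in_band_def by blast
qed

lemma ex_frac_in_band_if_fwd_diff_in_band:
  fixes g :: "nat \<Rightarrow> real"
  assumes "0 < \<delta>" "0 < \<delta>'" "\<delta>' < 1" "(real N' + 1) * \<delta> \<le> \<delta>' / 2"
    and M: "2 \<le> real M * \<delta>" "M + N' \<le> N"
    and band: "frac_in_band \<delta> (fwd_diff g) {a..a + N}"
  shows "\<exists>b. {b..b + N'} \<subseteq> {a..a + N} \<and> frac_in_band \<delta>' g {b..b + N'}"
proof -
  \<comment> \<open>\<open>h\<close> agrees with \<open>g\<close> modulo 1, but its differences are the fractional parts of those of \<open>g\<close>.\<close>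
  define h where "h m = g m - of_int (\<Sum>i = a..<m. \<lfloor>fwd_diff g i\<rfloor>)" for m
  have diff_h: "fwd_diff h m \<in> {\<delta> / 2..\<delta>}" if "m \<in> {a..a + N}" for m
  proof -
    have "fwd_diff h m = frac (fwd_diff g m)"
      using that by (simp add: h_def fwd_diff_def frac_def)
    then show ?thesis
      using band that by (simp add: frac_in_band_def)
  qed
  have "h (a + M) - h a \<in> {real M * (\<delta> / 2)..real M * \<delta>}"
    by (intro fwd_diff_bounds_increment diff_h) (use M(2) in auto)
  then have "h a + 1 \<le> h (a + M)"
    using M(1) by auto
  moreover have "fwd_diff h m \<in> {0..\<delta>}" if "m \<in> {a..<a + M + N'}" for m
    using diff_h[of m] that \<open>0 < \<delta>\<close> M(2) by auto
  ultimately obtain b where "b \<in> {a..a + M}" "frac_in_band \<delta>' h {b..b + N'}"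
    using ex_frac_in_band_if_slow_increase[of a "a + M" h \<delta>' \<delta> N'] assms by auto
  moreover have "frac (h m) = frac (g m)" for m
    unfolding h_def by (simp add: frac_def del: of_int_sum)
  ultimately show ?thesis
    using M(2) by (intro exI[of _ b]) (auto simp: frac_in_band_def)
qed

lemma ex_frac_in_band_power_step:
  fixes g :: "nat \<Rightarrow> real"
  assumes "T \<ge> 4" "d \<ge> 1"
    and "frac_in_band (1 / real T ^ (2 * d + 2)) (fwd_diff g) {a..a + T ^ (2 * d + 2 + 1)}"
  shows "\<exists>b. {b..b + T ^ (d + 1)} \<subseteq> {a..a + T ^ (2 * d + 2 + 1)} \<and>
           frac_in_band (1 / real T ^ d) g {b..b + T ^ (d + 1)}"
proof (rule ex_frac_in_band_if_fwd_diff_in_band)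
  have "1 \<le> real T ^ (d + 1)"
    using assms(1) by (intro one_le_power) simp
  then have "2 * (real T ^ (d + 1) + 1) \<le> 4 * real T ^ (d + 1)"
    by simp
  also have "\<dots> \<le> real T * real T ^ (d + 1)"
    using assms(1) by (intro mult_right_mono) auto
  finally have "2 * (real T ^ (d + 1) + 1) * real T ^ d \<le> real T * real T ^ (d + 1) * real T ^ d"
    by (rule mult_right_mono) simp
  also have "\<dots> = real T ^ (2 * d + 2)"
    by (simp add: power_add mult_2 power2_eq_square)
  finally have bound: "2 * (real T ^ (d + 1) + 1) * real T ^ d \<le> real T ^ (2 * d + 2)" .
  have scale: "u * (1 / v) \<le> 1 / w / 2" if "2 * u * w \<le> v" "v > 0" "w > 0" for u v w :: real
    using that by (simp add: field_simps)
  show "(real (T ^ (d + 1)) + 1) * (1 / real T ^ (2 * d + 2)) \<le> 1 / real T ^ d / 2"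
    unfolding of_nat_power by (rule scale[OF bound]) (use assms(1) in auto)
  have "T ^ (d + 1) \<le> T ^ (2 * d + 2)"
    using assms(1) by (intro power_increasing) auto
  moreover have "3 * T ^ (2 * d + 2) \<le> T * T ^ (2 * d + 2)"
    using assms(1) by (intro mult_right_mono) auto
  moreover have "T ^ (2 * d + 2 + 1) = T * T ^ (2 * d + 2)"
    by (simp only: Suc_eq_plus1[symmetric] power_Suc)
  ultimately show "2 * T ^ (2 * d + 2) + T ^ (d + 1) \<le> T ^ (2 * d + 2 + 1)"
    by linarith
  show "1 / real T ^ d < 1"
    using assms by simp
qed (use assms in auto)

primrec band_exponent :: "nat \<Rightarrow> nat" where
  "band_exponent 0 = 1"
| "band_exponent (Suc r) = 2 * band_exponent r + 2"

lemma band_exponent_ge_1: "1 \<le> band_exponent r"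
  by (induction r) auto

lemma ex_frac_in_band_descent:
  fixes f :: "nat \<Rightarrow> real"
  assumes "T \<ge> 4"
    and "frac_in_band (1 / real T ^ band_exponent r) ((fwd_diff ^^ r) f)
           {a..a + T ^ (band_exponent r + 1)}"
  shows "\<exists>b. {b..b + T} \<subseteq> {a..a + T ^ (band_exponent r + 1)} \<and> frac_in_band (1 / real T) f {b..b + T}"
  using assms(2)
proof (induction r arbitrary: a)
  case 0
  moreover have "{a..a + T} \<subseteq> {a..a + T ^ (1 + 1)}"
    using assms(1) by simp
  ultimately show ?case
    by (intro exI[of _ a]) (simp add: frac_in_band_subset)
next
  case (Suc r)
  let ?d = "band_exponent r"
  obtain b where b: "{b..b + T ^ (?d + 1)} \<subseteq> {a..a + T ^ (band_exponent (Suc r) + 1)}"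
    "frac_in_band (1 / real T ^ ?d) ((fwd_diff ^^ r) f) {b..b + T ^ (?d + 1)}"
    using ex_frac_in_band_power_step[OF assms(1) band_exponent_ge_1, of r "(fwd_diff ^^ r) f" a] Suc.prems
    unfolding funpow.simps o_apply band_exponent.simps by blast
  obtain b' where "{b'..b' + T} \<subseteq> {b..b + T ^ (?d + 1)}" "frac_in_band (1 / real T) f {b'..b' + T}"
    using Suc.IH[OF b(2)] by blast
  with b(1) show ?case
    by blast
qed

lemma ex_frac_in_band_if_slow_fwd_diff:
  fixes f :: "nat \<Rightarrow> real" and r T :: nat
  defines "N \<equiv> T ^ (band_exponent r + 1)"
  assumes "T \<ge> 4" "a \<le> b" "(fwd_diff ^^ r) f a + 1 \<le> (fwd_diff ^^ r) f b"
    and slow: "0 \<le> \<eta>" "4 * real T ^ (2 * band_exponent r + 1) * \<eta> \<le> 1"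
      "\<And>m. m \<in> {a..<b + N} \<Longrightarrow> (fwd_diff ^^ Suc r) f m \<in> {0..\<eta>}"
  shows "\<exists>n. {n..n + T} \<subseteq> {a..b + N} \<and> frac_in_band (1 / real T) f {n..n + T}"
proof -
  let ?d = "band_exponent r" and ?h = "(fwd_diff ^^ r) f"
  have "1 \<le> real N"
    using \<open>T \<ge> 4\<close> unfolding N_def of_nat_power by (intro one_le_power) simp
  then have "(real N + 1) * \<eta> \<le> (2 * real N) * \<eta>"
    using slow(1) by (intro mult_right_mono) auto
  also have "\<dots> \<le> 1 / (2 * real T ^ ?d)"
  proof (subst pos_le_divide_eq)
    have "2 * real N * \<eta> * (2 * real T ^ ?d) = 4 * (real N * real T ^ ?d) * \<eta>"
      by simp
    also have "real N * real T ^ ?d = real T ^ (2 * ?d + 1)"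
      unfolding N_def of_nat_power power_add[symmetric] by (simp only: mult_2 add_ac)
    finally show "2 * real N * \<eta> * (2 * real T ^ ?d) \<le> 1"
      using slow(2) by linarith
  qed (use \<open>T \<ge> 4\<close> in simp)
  finally have "(real N + 1) * \<eta> \<le> 1 / real T ^ ?d / 2"
    by simp
  moreover have "1 / real T ^ ?d < 1"
    using \<open>T \<ge> 4\<close> band_exponent_ge_1[of r] by simp
  ultimately obtain n where n: "n \<in> {a..b}" "frac_in_band (1 / real T ^ ?d) ?h {n..n + N}"
    using ex_frac_in_band_if_slow_increase[of a b ?h "1 / real T ^ ?d" \<eta> N] assms by auto
  then obtain n' where "{n'..n' + T} \<subseteq> {n..n + N}" "frac_in_band (1 / real T) f {n'..n' + T}"
    using ex_frac_in_band_descent[OF \<open>T \<ge> 4\<close>] unfolding N_def by blast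
  with n(1) show ?thesis
    by (intro exI[of _ n']) auto
qed

lemma fwd_diff_funpow_mean_value:
  fixes F :: "nat \<Rightarrow> real \<Rightarrow> real"
  assumes "\<And>k x. k < n \<Longrightarrow> x \<in> {a..a + real n} \<Longrightarrow> (F k has_real_derivative F (Suc k) x) (at x)"
  shows "\<exists>\<xi>\<in>{a..a + real n}. (fwd_diff ^^ n) (F 0) a = F n \<xi>"
  using assms
proof (induction n arbitrary: F)
  case 0
  then show ?case by simp
next
  case (Suc n)
  have "(fwd_diff (F k) has_real_derivative fwd_diff (F (Suc k)) x) (at x)"
    if "k < n" "x \<in> {a..a + real n}" for k x
  proof -
    have "((\<lambda>x. F k (x + 1)) has_real_derivative F (Suc k) (x + 1)) (at x)"
      using Suc.prems[of k "x + 1"] that by (simp add: DERIV_shift)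
    then show ?thesis
      using Suc.prems[of k x] that unfolding fwd_diff_def by (intro DERIV_diff) auto
  qed
  then obtain \<xi> where \<xi>: "\<xi> \<in> {a..a + real n}"
    "(fwd_diff ^^ n) (fwd_diff (F 0)) a = fwd_diff (F n) \<xi>"
    using Suc.IH[of "\<lambda>k. fwd_diff (F k)"] by blast
  obtain z where "\<xi> < z" "z < \<xi> + 1" "F n (\<xi> + 1) - F n \<xi> = (\<xi> + 1 - \<xi>) * F (Suc n) z"
    using MVT2[of \<xi> "\<xi> + 1" "F n" "F (Suc n)"] Suc.prems \<xi>(1) by force
  then have "z \<in> {a..a + real (Suc n)}" "fwd_diff (F n) \<xi> = F (Suc n) z"
    using \<xi>(1) by (auto simp: fwd_diff_def)
  then show ?case
    using \<xi>(2) by (intro bexI[of _ z]) (simp_all add: funpow_Suc_right del: funpow.simps)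
qed

lemma fwd_diff_funpow_powr_mean_value:
  fixes c \<kappa> :: real
  assumes "m > 0"
  shows "\<exists>\<xi>\<in>{real m..real m + real n}.
    (fwd_diff ^^ n) (\<lambda>m. \<kappa> * real m powr c) m = \<kappa> * (\<Prod>i<n. c - real i) * \<xi> powr (c - real n)"
proof -
  define F where "F k x = \<kappa> * (\<Prod>i<k. c - real i) * x powr (c - real k)" for k and x :: real
  have "(F k has_real_derivative F (Suc k) x) (at x)" if "x > 0" for k x
    unfolding F_def using that by (auto intro!: derivative_eq_intros simp: algebra_simps)
  then have "\<exists>\<xi>\<in>{real m..real m + real n}. (fwd_diff ^^ n) (F 0) (real m) = F n \<xi>"
    using assms by (intro fwd_diff_funpow_mean_value) auto
  moreover have "(fwd_diff ^^ n) (\<lambda>m. \<kappa> * real m powr c) m = (fwd_diff ^^ n) (F 0) (real m)"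
    using fwd_diff_funpow_of_nat[of n "F 0" m] by (simp add: F_def)
  ultimately show ?thesis
    by (simp add: F_def)
qed

lemma prod_diff_of_nat_pos: "0 < (\<Prod>i<nat \<lfloor>c\<rfloor>. c - real i)"
  by (intro prod_pos) (auto, linarith)

lemma fwd_diff_funpow_powr_bounds:
  fixes c \<kappa> :: real
  assumes "c > 0" "c \<notin> \<int>" "\<kappa> > 0"
  defines "r \<equiv> nat \<lfloor>c\<rfloor>" and "f \<equiv> \<lambda>m::nat. \<kappa> * real m powr c"
  shows "\<exists>C>0. \<forall>m>0.
    (fwd_diff ^^ r) f m \<in> {C * real m powr frac c..C * (real m + real r) powr frac c} \<and>
    (fwd_diff ^^ Suc r) f m \<in> {0..C * real m powr (frac c - 1)}"
proof -
  define C where "C = \<kappa> * (\<Prod>i<r. c - real i)"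
  have r: "real r = of_int \<lfloor>c\<rfloor>"
    using \<open>c > 0\<close> by (simp add: r_def)
  have frac_c: "0 < frac c" "frac c < 1" "c - real r = frac c"
    using \<open>c \<notin> \<int>\<close> by (simp_all add: frac_lt_1) (simp add: frac_def r)
  have "C > 0"
    unfolding C_def r_def using \<open>\<kappa> > 0\<close> by (intro mult_pos_pos prod_diff_of_nat_pos)
  moreover have "(fwd_diff ^^ r) f m \<in> {C * real m powr frac c..C * (real m + real r) powr frac c}"
    if "m > 0" for m
  proof -
    obtain \<xi> where "\<xi> \<in> {real m..real m + real r}" "(fwd_diff ^^ r) f m = C * \<xi> powr frac c"
      using fwd_diff_funpow_powr_mean_value[OF \<open>m > 0\<close>, of r \<kappa> c] frac_c(3)
      unfolding f_def C_def by auto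
    then show ?thesis
      using \<open>C > 0\<close> frac_c(1) by (auto intro!: mult_left_mono powr_mono2)
  qed
  moreover have "(fwd_diff ^^ Suc r) f m \<in> {0..C * real m powr (frac c - 1)}" if "m > 0" for m
  proof -
    obtain \<xi> where \<xi>: "\<xi> \<in> {real m..real m + real (Suc r)}"
      "(fwd_diff ^^ Suc r) f m = \<kappa> * (\<Prod>i<Suc r. c - real i) * \<xi> powr (c - real (Suc r))"
      using fwd_diff_funpow_powr_mean_value[OF \<open>m > 0\<close>, of "Suc r" \<kappa> c] unfolding f_def by blast
    moreover have "c - (1 + real r) = frac c - 1"
      using frac_c(3) by simp
    ultimately have "(fwd_diff ^^ Suc r) f m = C * (frac c * \<xi> powr (frac c - 1))"
      by (simp add: C_def frac_c(3))
    moreover have "\<xi> powr (frac c - 1) \<le> real m powr (frac c - 1)"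
      using \<xi>(1) \<open>m > 0\<close> frac_c by (intro powr_mono2') auto
    then have "frac c * \<xi> powr (frac c - 1) \<le> 1 * real m powr (frac c - 1)"
      using frac_c by (intro mult_mono) auto
    ultimately show ?thesis
      using \<open>C > 0\<close> frac_c(1) by simp
  qed
  ultimately show ?thesis
    by (intro exI[of _ C]) blast
qed

lemma ex_power_log_scales:
  fixes C s \<rho> B :: real and T\<^sub>0 d e :: nat
  assumes "C > 0" "0 < s" "s < 1" "\<rho> \<ge> 0"
  shows "\<exists>T\<ge>T\<^sub>0. \<exists>a\<ge>2. C * (real a + \<rho>) powr s + 1 \<le> C * real (a ^ 2) powr s \<and>
    4 * real T ^ d * (C * real a powr (s - 1)) \<le> 1 \<and> T ^ e \<le> a \<and> B * log 2 (real a) \<le> real T"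
proof -
  define K where "K = nat \<lceil>B\<rceil> + 1"
  have K: "real K \<ge> B" "real K > 0" "K \<ge> 1"
    unfolding K_def by linarith+
  have "\<forall>\<^sub>F k :: nat in sequentially.
      C * (2 ^ k + \<rho>) powr s + 1 \<le> C * ((2 ^ k) ^ 2) powr s \<and>
      4 * (real K * real k) ^ d * (C * (2 ^ k) powr (s - 1)) \<le> 1 \<and>
      (real K * real k) ^ e \<le> 2 ^ k \<and> k \<ge> max 1 T\<^sub>0"
    by (intro eventually_conj eventually_ge_at_top; use assms K(2) in real_asymp)
  then obtain k :: nat where
    k: "C * (2 ^ k + \<rho>) powr s + 1 \<le> C * ((2 ^ k) ^ 2) powr s"
      "4 * (real K * real k) ^ d * (C * (2 ^ k) powr (s - 1)) \<le> 1"
      "(real K * real k) ^ e \<le> 2 ^ k" "1 \<le> k" "T\<^sub>0 \<le> k"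
    by (auto simp: eventually_sequentially)
  have "real ((K * k) ^ e) \<le> real (2 ^ k)"
    using k(3) by simp
  then have "(K * k) ^ e \<le> 2 ^ k"
    by (simp only: of_nat_le_iff)
  moreover have "B * log 2 (real (2 ^ k)) \<le> real (K * k)"
    using K(1) by (simp add: mult_right_mono)
  moreover have "T\<^sub>0 \<le> K * k"
    using mult_mono[of 1 K T\<^sub>0 k] K(3) k(5) by simp
  moreover have "2 \<le> (2 :: nat) ^ k"
    using k(4) by (simp add: self_le_power)
  ultimately show ?thesis
    using k by (intro exI[of _ "K * k", OF conjI[OF _ exI[of _ "2 ^ k"]]] conjI) auto
qed

lemma log_2_le_if_le_double_square:
  assumes "0 < n" "n \<le> 2 * a ^ 2" "2 \<le> a"
  shows "log 2 (real n) \<le> 3 * log 2 (real a)"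
proof -
  have "n \<le> a * a ^ 2"
    using assms(2) mult_right_mono[OF \<open>2 \<le> a\<close>, of "a ^ 2"] by linarith
  then have "real n \<le> real (a * a ^ 2)"
    by (rule of_nat_mono)
  also have "\<dots> = real a ^ 3"
    by (simp add: power2_eq_square power3_eq_cube)
  finally have "log 2 (real n) \<le> log 2 (real a ^ 3)"
    using \<open>0 < n\<close> by (intro log_mono) auto
  also have "\<dots> = 3 * log 2 (real a)"
    using \<open>2 \<le> a\<close> by (simp add: log_nat_power)
  finally show ?thesis .
qed

lemma ex_long_frac_in_band_powr:
  fixes c \<kappa> B :: real and T\<^sub>0 :: nat
  assumes "c > 0" "c \<notin> \<int>" "\<kappa> > 0" "B \<ge> 0"
  shows "\<exists>b\<ge>1. \<exists>T\<ge>T\<^sub>0. B * log 2 (real (b + T)) \<le> real T \<and>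
    frac_in_band (1 / real T) (\<lambda>m. \<kappa> * real m powr c) {b..b + T}"
proof -
  define r where "r = nat \<lfloor>c\<rfloor>"
  define f where "f m = \<kappa> * real m powr c" for m :: nat
  define N where "N T = T ^ (band_exponent r + 1)" for T :: nat
  have frac_c: "0 < frac c" "frac c < 1"
    using assms(2) by (auto simp: frac_lt_1)
  obtain C where "C > 0" and diff_bounds: "\<And>m. m > 0 \<Longrightarrow>
      (fwd_diff ^^ r) f m \<in> {C * real m powr frac c..C * (real m + real r) powr frac c} \<and>
      (fwd_diff ^^ Suc r) f m \<in> {0..C * real m powr (frac c - 1)}"
    using fwd_diff_funpow_powr_bounds[OF assms(1-3)] unfolding r_def f_def by blast
  obtain T a where T: "T \<ge> max 4 T\<^sub>0" and a: "a \<ge> 2"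
    and growth: "C * (real a + real r) powr frac c + 1 \<le> C * real (a ^ 2) powr frac c"
    and slow: "4 * real T ^ (2 * band_exponent r + 1) * (C * real a powr (frac c - 1)) \<le> 1"
    and short: "N T \<le> a" and long: "(B * 3) * log 2 (real a) \<le> real T"
    using ex_power_log_scales[OF \<open>C > 0\<close> frac_c, of "real r"] unfolding N_def
    by (metis of_nat_0_le_iff)
  have "a \<le> a ^ 2"
    using a by (simp add: self_le_power)
  have "(fwd_diff ^^ r) f a + 1 \<le> (fwd_diff ^^ r) f (a ^ 2)"
    using growth diff_bounds[of a] diff_bounds[of "a ^ 2"] a by simp
  moreover have "(fwd_diff ^^ Suc r) f m \<in> {0..C * real a powr (frac c - 1)}" if "m \<ge> a" for m
  proof -
    have "C * real m powr (frac c - 1) \<le> C * real a powr (frac c - 1)"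
      using \<open>C > 0\<close> frac_c(2) a that by (intro mult_left_mono powr_mono2') auto
    then show ?thesis
      using diff_bounds[of m] a that by auto
  qed
  ultimately obtain b where b: "{b..b + T} \<subseteq> {a..a ^ 2 + N T}" "frac_in_band (1 / real T) f {b..b + T}"
    using ex_frac_in_band_if_slow_fwd_diff[of T a "a ^ 2" r f "C * real a powr (frac c - 1)"]
      slow T \<open>a \<le> a ^ 2\<close> \<open>C > 0\<close> unfolding N_def by auto
  have "b + T \<le> 2 * a ^ 2"
    using b(1) short \<open>a \<le> a ^ 2\<close> by auto
  then have "log 2 (real (b + T)) \<le> 3 * log 2 (real a)"
    using T a by (intro log_2_le_if_le_double_square) auto
  then have "B * log 2 (real (b + T)) \<le> real T"
    using long mult_left_mono[OF _ \<open>B \<ge> 0\<close>] by fastforce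
  then show ?thesis
    using b a T unfolding f_def by (intro exI[of _ b] exI[of _ T] conjI) auto
qed

lemma dvd_nat_floor_if_frac_less:
  assumes "x \<ge> 0" "q > 0" "frac (x / real q) < 1 / real q"
  shows "q dvd nat \<lfloor>x\<rfloor>"
proof -
  define k where "k = \<lfloor>x / real q\<rfloor>"
  have "x = real q * k + real q * frac (x / real q)"
    using assms(2) by (simp add: k_def frac_def field_simps)
  moreover have "0 \<le> real q * frac (x / real q)" "real q * frac (x / real q) < 1"
    using assms by (simp_all add: field_simps)
  ultimately have "real q * k \<le> x" "x < real q * k + 1"
    by linarith+
  then have "\<lfloor>x\<rfloor> = int q * k"
    by (simp add: floor_eq_iff)
  then show ?thesis
    using assms by (simp add: nat_mult_distrib)
qed

lemma totient_ratio_nat_floor_le_if_frac_less: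
  assumes "x \<ge> 1" "q > 0" "frac (x / real q) < 1 / real q"
  shows "totient_ratio (nat \<lfloor>x\<rfloor>) \<le> totient_ratio q"
  using assms by (intro totient_ratio_dvd_mono dvd_nat_floor_if_frac_less) auto

lemma totient_ratio_nat_floor_powr_ge:
  fixes c :: real
  assumes "c > 0" "m > 0"
  shows "1 / (c * log 2 (real m) + 1) \<le> totient_ratio (nat \<lfloor>real m powr c\<rfloor>)"
proof -
  have pos: "nat \<lfloor>real m powr c\<rfloor> > 0"
    using assms by (simp add: ge_one_powr_ge_zero)
  have "log 2 (real (nat \<lfloor>real m powr c\<rfloor>)) \<le> log 2 (real m powr c)"
    using pos by (intro log_mono) auto
  also have "\<dots> = c * log 2 (real m)"
    using assms by (simp add: log_powr)
  finally have "1 / (c * log 2 (real m) + 1) \<le> 1 / (log 2 (real (nat \<lfloor>real m powr c\<rfloor>)) + 1)"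
    using assms pos by (intro divide_left_mono mult_pos_pos add_nonneg_pos) auto
  also have "\<dots> \<le> totient_ratio (nat \<lfloor>real m powr c\<rfloor>)"
    by (rule totient_ratio_ge_log[OF pos])
  finally show ?thesis .
qed

lemma has_heavy_block_totient_ratio_powr:
  fixes c \<epsilon> :: real
  assumes "c > 0" "c \<notin> \<int>" "\<epsilon> > 0"
  shows "has_heavy_block (\<lambda>m. totient_ratio (nat \<lfloor>real m powr c\<rfloor>)) \<epsilon>"
proof -
  let ?w = "\<lambda>m. totient_ratio (nat \<lfloor>real m powr c\<rfloor>)"
  obtain q where q: "q > 0" "totient_ratio q < \<epsilon>"
    using ex_totient_ratio_less[OF \<open>\<epsilon> > 0\<close>] by blast
  obtain b T where b: "b \<ge> 1" and "T \<ge> q + 1" and T: "(c + 1) * log 2 (real (b + T)) \<le> real T"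
    and band: "frac_in_band (1 / real T) (\<lambda>m. 1 / real q * real m powr c) {b..b + T}"
    using ex_long_frac_in_band_powr[OF assms(1,2), of "1 / real q" "c + 1" "q + 1"] q(1) assms(1)
    by auto
  have "?w (b + j) \<le> \<epsilon>" if "j \<in> {1..T}" for j
  proof -
    have "frac (real (b + j) powr c / real q) \<le> 1 / real T"
      using bspec[OF band[unfolded frac_in_band_def], of "b + j"] that by simp
    also have "\<dots> < 1 / real q"
      using \<open>T \<ge> q + 1\<close> q(1) by (intro divide_strict_left_mono) auto
    finally have "?w (b + j) \<le> totient_ratio q"
      using b \<open>c > 0\<close> q(1)
      by (intro totient_ratio_nat_floor_le_if_frac_less ge_one_powr_ge_zero) auto
    then show ?thesis
      using q(2) by linarith
  qed
  moreover have "1 / real T \<le> ?w (b + j)" if "j \<in> {1..T}" for j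
  proof -
    have "1 \<le> log 2 (real (b + T))"
      using b \<open>T \<ge> q + 1\<close> by (simp add: le_log_iff)
    moreover have "c * log 2 (real (b + j)) \<le> c * log 2 (real (b + T))"
      using b \<open>c > 0\<close> that by (intro mult_left_mono log_mono) auto
    ultimately have "c * log 2 (real (b + j)) + 1 \<le> real T"
      using T by (simp add: algebra_simps)
    then have "1 / real T \<le> 1 / (c * log 2 (real (b + j)) + 1)"
      using b \<open>c > 0\<close> that by (intro divide_left_mono mult_pos_pos add_nonneg_pos) auto
    also have "\<dots> \<le> ?w (b + j)"
      using b \<open>c > 0\<close> by (intro totient_ratio_nat_floor_powr_ge) auto
    finally show ?thesis .
  qed
  ultimately show ?thesis
    using \<open>T \<ge> q + 1\<close> by (intro has_heavy_block_if_ge_inverse[of T _ b]) auto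
qed

section \<open>Integer exponents\<close>

definition primes_between :: "nat \<Rightarrow> nat \<Rightarrow> nat set" where
  "primes_between y z = {p \<in> {y<..z}. prime p}"

lemma finite_primes_between [simp]: "finite (primes_between y z)"
  by (simp add: primes_between_def)

lemma euler_prod_primes_between_pos: "0 < euler_prod (primes_between y z)"
  by (rule euler_prod_pos) (auto simp: primes_between_def prime_ge_2_nat)

lemma ex_euler_prod_primes_between_less:
  assumes "\<epsilon> > 0"
  shows "\<exists>z\<ge>y. euler_prod (primes_between y z) < \<epsilon>"
proof -
  let ?B = "primes_between 0 y"
  have ge_2: "?B \<subseteq> {2..}" "primes_between y z \<subseteq> {2..}" for z
    by (auto simp: primes_between_def prime_ge_2_nat)
  have "euler_prod ?B > 0"
    by (rule euler_prod_primes_between_pos)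
  then obtain n where n: "n > 0" "totient_ratio n < \<epsilon> * euler_prod ?B"
    using ex_totient_ratio_less[of "\<epsilon> * euler_prod ?B"] assms by auto
  define z where "z = max y n"
  have "prime_factors n \<subseteq> ?B \<union> primes_between y z"
    using n(1) by (auto simp: primes_between_def z_def in_prime_factors_iff prime_gt_0_nat dvd_imp_le le_max_iff_disj)
  then have "euler_prod (?B \<union> primes_between y z) \<le> totient_ratio n"
    unfolding totient_ratio_eq_euler_prod[OF n(1)] using ge_2 by (intro euler_prod_antimono) auto
  moreover have "euler_prod (?B \<union> primes_between y z) = euler_prod ?B * euler_prod (primes_between y z)"
    by (intro euler_prod_Un_disjoint) (auto simp: primes_between_def)
  ultimately have "euler_prod ?B * euler_prod (primes_between y z) < euler_prod ?B * \<epsilon>"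
    using n(2) by (simp add: mult.commute)
  then have "euler_prod (primes_between y z) < \<epsilon>"
    using \<open>euler_prod ?B > 0\<close> by simp
  then show ?thesis
    by (intro exI[of _ z]) (simp add: z_def)
qed

lemma euler_prod_primes_between_Suc:
  "euler_prod (primes_between y z) / 2 \<le> euler_prod (primes_between y (Suc z))"
proof (cases "prime (Suc z) \<and> y \<le> z")
  case True
  then have "primes_between y (Suc z) = insert (Suc z) (primes_between y z)"
    by (auto simp: primes_between_def)
  then have "euler_prod (primes_between y (Suc z))
      = (1 - 1 / real (Suc z)) * euler_prod (primes_between y z)"
    by (simp add: euler_prod_def primes_between_def)
  moreover have "1 / 2 \<le> 1 - 1 / real (Suc z)"
    using True prime_ge_2_nat[of "Suc z"] by (simp add: field_simps)
  then have "1 / 2 * euler_prod (primes_between y z)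
      \<le> (1 - 1 / real (Suc z)) * euler_prod (primes_between y z)"
    using less_imp_le[OF euler_prod_primes_between_pos] by (rule mult_right_mono)
  ultimately show ?thesis
    by simp
next
  case False
  then have "primes_between y (Suc z) = primes_between y z"
    by (auto simp: primes_between_def le_Suc_eq)
  then show ?thesis
    using euler_prod_primes_between_pos[of y z] by simp
qed

lemma ex_euler_prod_primes_between:
  assumes "0 < \<epsilon>" "\<epsilon> \<le> 1"
  shows "\<exists>z\<ge>y. euler_prod (primes_between y z) \<in> {\<epsilon> / 2..\<epsilon>}"
proof -
  note pos = euler_prod_primes_between_pos[of y]
  define h where "h z = - ln (euler_prod (primes_between y z))" for z
  obtain z where "z \<ge> y" "euler_prod (primes_between y z) < \<epsilon>"
    using ex_euler_prod_primes_between_less[OF \<open>0 < \<epsilon>\<close>] by blast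
  then have "- ln \<epsilon> \<le> h z"
    using pos[of z] by (simp add: h_def)
  moreover have "h y \<le> - ln \<epsilon>"
    using assms by (simp add: h_def euler_prod_def primes_between_def)
  moreover have "h (Suc n) \<le> h n + ln 2" for n
  proof -
    have "ln (euler_prod (primes_between y n) / 2) \<le> ln (euler_prod (primes_between y (Suc n)))"
      using pos[of n] euler_prod_primes_between_Suc by (intro ln_mono) auto
    then show ?thesis
      using pos[of n] by (simp add: h_def ln_div)
  qed
  ultimately obtain n where "n \<in> {y..z}" and h_n: "h n \<in> {- ln \<epsilon>..- ln \<epsilon> + ln 2}"
    using ex_between_if_small_steps[of y z h "- ln \<epsilon>" "ln 2"] \<open>z \<ge> y\<close> by auto
  moreover have "ln (\<epsilon> / 2) \<le> ln (euler_prod (primes_between y n))"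
    "ln (euler_prod (primes_between y n)) \<le> ln \<epsilon>"
    using h_n \<open>0 < \<epsilon>\<close> by (simp_all add: h_def ln_div)
  ultimately show ?thesis
    using pos[of n] \<open>0 < \<epsilon>\<close> by (intro exI[of _ n]) auto
qed

lemma ex_disjoint_prime_sets:
  assumes "0 < \<epsilon>" "\<epsilon> \<le> 1"
  shows "\<exists>A :: nat \<Rightarrow> nat set. disjoint_family A \<and>
    (\<forall>j. finite (A j) \<and> (\<forall>p\<in>A j. prime p \<and> y < p) \<and> euler_prod (A j) \<in> {\<epsilon> / 2..\<epsilon>})"
proof -
  obtain next_end where next_end: "\<And>y. y \<le> next_end y"
    "\<And>y. euler_prod (primes_between y (next_end y)) \<in> {\<epsilon> / 2..\<epsilon>}"
    using ex_euler_prod_primes_between[OF assms] by metis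
  define Y where "Y j = (next_end ^^ j) y" for j
  define A where "A j = primes_between (Y j) (Y (Suc j))" for j
  have Y_Suc: "Y (Suc j) = next_end (Y j)" for j
    by (simp add: Y_def)
  have Y_mono: "Y i \<le> Y j" if "i \<le> j" for i j
    using that by (rule lift_Suc_mono_le[rotated]) (simp add: Y_Suc next_end)
  have "disjoint_family (\<lambda>j. {..Y (Suc j)} - {..Y j})"
    using Y_mono by (intro disjoint_family_Suc) simp
  then have "disjoint_family A"
    by (rule disjoint_family_on_bisimulation) (auto simp: A_def primes_between_def)
  moreover have "euler_prod (A j) \<in> {\<epsilon> / 2..\<epsilon>}" for j
    using next_end(2) by (simp add: A_def Y_Suc)
  moreover have "y < p" if "p \<in> A j" for p j
    using that Y_mono[of 0 j] by (simp add: A_def Y_def primes_between_def)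
  ultimately show ?thesis
    by (intro exI[of _ A]) (auto simp: A_def primes_between_def)
qed

lemma ex_dvd_shifts:
  fixes A :: "nat \<Rightarrow> nat set"
  assumes "finite J" "disjoint_family_on A J"
    and "\<And>j. j \<in> J \<Longrightarrow> finite (A j)" "\<And>j p. j \<in> J \<Longrightarrow> p \<in> A j \<Longrightarrow> prime p"
  shows "\<exists>x. \<forall>j\<in>J. \<forall>p\<in>A j. p dvd x + j"
proof -
  let ?W = "\<Union>j\<in>J. A j"
  \<comment> \<open>\<open>(p - 1) * l\<close> stands for \<open>- l\<close> modulo \<open>p\<close>.\<close>
  define shift where "shift p = (THE j. j \<in> J \<and> p \<in> A j)" for p
  have shift: "shift p = j" if "j \<in> J" "p \<in> A j" for j p
    unfolding shift_def using that assms(2)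
    by (intro the_equality) (auto simp: disjoint_family_on_def)
  have "finite ?W" "\<forall>p\<in>?W. \<forall>p'\<in>?W. p \<noteq> p' \<longrightarrow> coprime p p'"
    using assms(1,3,4) by (auto intro: primes_coprime)
  then obtain x where x: "\<And>p. p \<in> ?W \<Longrightarrow> [x = (p - 1) * shift p] (mod p)"
    using chinese_remainder_nat[of ?W "\<lambda>p. p" "\<lambda>p. (p - 1) * shift p"] by blast
  have "p dvd x + j" if "j \<in> J" "p \<in> A j" for j p
  proof -
    have "[x + j = (p - 1) * j + j] (mod p)"
      using x[of p] that shift[OF that] by (intro cong_add) auto
    moreover have "(p - 1) * j + j = p * j"
      using assms(4)[OF that] by (simp add: algebra_simps prime_gt_0_nat Suc_leI)
    ultimately show ?thesis
      by (simp add: cong_dvd_iff)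
  qed
  then show ?thesis by blast
qed

lemma prime_factors_shift_Int:
  fixes A :: "nat \<Rightarrow> nat set"
  assumes "\<And>i p. i \<in> {1..K} \<Longrightarrow> p \<in> A i \<Longrightarrow> prime p \<and> K < p \<and> p dvd a + i" "j \<in> {1..K}"
  shows "prime_factors (a + j) \<inter> (\<Union>i\<in>{1..K}. A i) = A j"
proof (intro equalityI subsetI)
  fix p assume "p \<in> prime_factors (a + j) \<inter> (\<Union>i\<in>{1..K}. A i)"
  then obtain i where i: "i \<in> {1..K}" "p \<in> A i" and "p dvd a + j"
    by auto
  have "[a + i = a + j] (mod p)"
    using assms(1)[OF i] \<open>p dvd a + j\<close> by (auto simp: cong_def)
  then have "[i = j] (mod p)"
    by (simp add: cong_add_lcancel_nat)
  then have "i = j"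
    using assms(1)[OF i] assms(2) i(1) by (intro cong_less_modulus_unique_nat[of i j p]) auto
  then show "p \<in> A j"
    using i(2) by simp
next
  fix p assume "p \<in> A j"
  then show "p \<in> prime_factors (a + j) \<inter> (\<Union>i\<in>{1..K}. A i)"
    using assms(1)[OF assms(2)] assms(2) by (auto simp: in_prime_factors_iff)
qed

definition new_prime_sum :: "nat \<Rightarrow> nat \<Rightarrow> real" where
  "new_prime_sum R n = (\<Sum>p\<in>prime_factors n - prime_factors R. 1 / real p)"

lemma totient_ratio_ge_new_prime_sum:
  assumes "n > 0"
  shows "euler_prod (prime_factors n \<inter> prime_factors R) * exp (- 2 * new_prime_sum R n)
    \<le> totient_ratio n"
proof -
  let ?P = "prime_factors n" and ?Q = "prime_factors R"
  have ge_2: "?P \<inter> ?Q \<subseteq> {2..}" "?P - ?Q \<subseteq> {2..}"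
    using prime_factors_subset_atLeast_2[of n] by auto
  have "totient_ratio n = euler_prod ((?P \<inter> ?Q) \<union> (?P - ?Q))"
    using assms by (simp add: totient_ratio_eq_euler_prod Int_Diff_Un)
  also have "\<dots> = euler_prod (?P \<inter> ?Q) * euler_prod (?P - ?Q)"
    by (intro euler_prod_Un_disjoint) auto
  also have "\<dots> \<ge> euler_prod (?P \<inter> ?Q) * exp (- 2 * new_prime_sum R n)"
    unfolding new_prime_sum_def
    by (intro mult_left_mono euler_prod_ge_exp less_imp_le[OF euler_prod_pos] ge_2) simp
  finally show ?thesis .
qed

lemma card_progression_multiples_le:
  fixes p R x X :: nat
  assumes "coprime p R" "p > 0"
  shows "real (card {t\<in>{..<X}. p dvd x + t * R}) \<le> real X / real p + 1"
proof -
  let ?S = "{t\<in>{..<X}. p dvd x + t * R}"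
  have mod_eq: "s mod p = t mod p" if "s \<in> ?S" "t \<in> ?S" for s t
  proof -
    have "[x + s * R = x + t * R] (mod p)"
      using that by (auto simp: cong_def)
    then have "[s = t] (mod p)"
      using assms(1) by (simp add: cong_add_lcancel_nat cong_mult_rcancel_nat coprime_commute)
    then show ?thesis
      by (simp add: cong_def)
  qed
  have "inj_on (\<lambda>t. t div p) ?S"
  proof (rule inj_onI)
    fix s t assume "s \<in> ?S" "t \<in> ?S" "s div p = t div p"
    then show "s = t"
      using mod_eq[of s t] by (metis div_mult_mod_eq)
  qed
  moreover have "(\<lambda>t. t div p) ` ?S \<subseteq> {..X div p}"
    by (auto intro!: div_le_mono)
  ultimately have "card ?S \<le> card {..X div p}"
    by (intro card_inj_on_le) auto
  then have "real (card ?S) \<le> real (X div p) + 1"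
    by simp
  also have "\<dots> \<le> real X / real p + 1"
    by (simp add: of_nat_div_le_of_nat)
  finally show ?thesis .
qed

lemma sum_inverse_squares_le: "(\<Sum>n = 2..N. 1 / real n ^ 2) \<le> 1"
proof (cases "N \<ge> 1")
  case True
  then have "(\<Sum>n = 2..N. 1 / real n ^ 2) \<le> 1 - 1 / real N"
  proof (induction N rule: dec_induct)
    case (step N)
    have "1 / (real N + 1) ^ 2 \<le> 1 / (real N * (real N + 1))"
      using step by (intro divide_left_mono) (auto simp: power2_eq_square)
    also have "\<dots> = 1 / real N - 1 / (real N + 1)"
      using step by (simp add: field_simps)
    finally show ?case
      using step by (simp add: add.commute)
  qed simp
  then show ?thesis
    by (rule order_trans) simp
qed simp

lemma new_prime_sum_eq_sum_if_dvd:
  assumes "n \<in> {1..N}" "R > 0"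
  shows "new_prime_sum R n
    = (\<Sum>p\<in>{p\<in>primes_between 1 N. coprime p R}. if p dvd n then 1 / real p else 0)"
proof -
  have "p \<le> N" if "p dvd n" for p
    using dvd_imp_le[OF that] assms(1) by auto
  moreover have "coprime p R \<longleftrightarrow> \<not> p dvd R" if "prime p" for p
    using that by (metis coprime_absorb_left not_prime_unit prime_imp_coprime)
  ultimately have "prime_factors n - prime_factors R
      = {p\<in>{p\<in>primes_between 1 N. coprime p R}. p dvd n}"
    using assms by (auto simp: primes_between_def in_prime_factors_iff prime_gt_Suc_0_nat)
  then show ?thesis
    by (auto simp: new_prime_sum_def sum.inter_filter intro!: sum.cong)
qed

lemma sum_new_prime_sum_progression_le:
  fixes x R X :: nat
  assumes "x > 0" "R > 0"
  shows "(\<Sum>t<X. new_prime_sum R (x + t * R)) \<le> real X + harm (x + X * R)"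
proof -
  define N where "N = x + X * R"
  define P where "P = {p\<in>primes_between 1 N. coprime p R}"
  have "x + t * R \<in> {1..N}" if "t < X" for t
    using that \<open>x > 0\<close> by (simp add: N_def)
  then have "(\<Sum>t<X. new_prime_sum R (x + t * R))
      = (\<Sum>t<X. \<Sum>p\<in>P. if p dvd x + t * R then 1 / real p else 0)"
    unfolding P_def using \<open>R > 0\<close> by (intro sum.cong new_prime_sum_eq_sum_if_dvd) auto
  also have "\<dots> = (\<Sum>p\<in>P. \<Sum>t<X. if p dvd x + t * R then 1 / real p else 0)"
    by (rule sum.swap)
  also have "\<dots> = (\<Sum>p\<in>P. real (card {t\<in>{..<X}. p dvd x + t * R}) * (1 / real p))"
    by (intro sum.cong refl) (simp add: sum.inter_filter[symmetric])
  also have "\<dots> \<le> (\<Sum>p\<in>P. (real X / real p + 1) * (1 / real p))"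
    by (intro sum_mono mult_right_mono card_progression_multiples_le)
      (auto simp: P_def primes_between_def)
  also have "\<dots> = real X * (\<Sum>p\<in>P. 1 / real p ^ 2) + (\<Sum>p\<in>P. 1 / real p)"
    by (simp add: sum.distrib[symmetric] sum_distrib_left power2_eq_square algebra_simps)
  also have "\<dots> \<le> real X * (\<Sum>p = 2..N. 1 / real p ^ 2) + (\<Sum>p = 1..N. 1 / real p)"
    by (intro add_mono mult_left_mono sum_mono2) (auto simp: P_def primes_between_def)
  also have "\<dots> \<le> real X * 1 + harm N"
    by (intro add_mono mult_left_mono sum_inverse_squares_le)
      (auto simp: harm_def inverse_eq_divide)
  finally show ?thesis
    by (simp add: N_def)
qed

lemma harm_le_ln: "n > 0 \<Longrightarrow> harm n \<le> 1 + ln (real n)"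
  using euler_mascheroni_sequence_decreasing[of 1 n] by (simp add: harm_expand)

lemma ex_progression_new_prime_sum_le:
  fixes x R K :: nat
  assumes "R > 0"
  shows "\<exists>t. (\<Sum>j = 1..K. new_prime_sum R (x + t * R + j)) \<le> 2 * real K"
proof (rule ccontr)
  assume "\<not> ?thesis"
  then have large: "2 * real K < (\<Sum>j = 1..K. new_prime_sum R (x + t * R + j))" for t
    by (simp add: not_le)
  have "\<forall>\<^sub>F X in sequentially. 1 + ln (real (x + K + 1) + real X * real R) \<le> real X \<and> 0 < X"
    using assms by (intro eventually_conj eventually_gt_at_top) real_asymp
  then obtain X where X: "1 + ln (real (x + K + 1) + real X * real R) \<le> real X" "0 < X"
    by (auto simp: eventually_sequentially)
  have "(\<Sum>t<X. new_prime_sum R (x + t * R + j)) \<le> 2 * real X" if "j \<in> {1..K}" for j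
  proof -
    have "(\<Sum>t<X. new_prime_sum R (x + j + t * R)) \<le> real X + harm (x + j + X * R)"
      using assms that by (intro sum_new_prime_sum_progression_le) auto
    also have "harm (x + j + X * R) \<le> 1 + ln (real (x + j + X * R))"
      using that by (intro harm_le_ln) simp
    also have "\<dots> \<le> 1 + ln (real (x + K + 1 + X * R))"
      using that by (intro add_left_mono ln_mono) (simp_all del: of_nat_add of_nat_mult)
    finally show ?thesis
      using X(1) by (simp add: add_ac)
  qed
  then have "(\<Sum>j = 1..K. \<Sum>t<X. new_prime_sum R (x + t * R + j)) \<le> (\<Sum>j = 1..K. 2 * real X)"
    by (intro sum_mono) auto
  then have "(\<Sum>t<X. \<Sum>j = 1..K. new_prime_sum R (x + t * R + j)) \<le> real X * (2 * real K)"
    by (subst sum.swap) (simp add: mult_ac)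
  moreover have "(\<Sum>t<X. 2 * real K) < (\<Sum>t<X. \<Sum>j = 1..K. new_prime_sum R (x + t * R + j))"
    using X(2) large by (intro sum_strict_mono) auto
  ultimately show False
    by simp
qed

lemma card_mult_exp_le_sum_exp:
  fixes f :: "'a \<Rightarrow> real"
  assumes "real (card J) * \<mu> \<le> (\<Sum>j\<in>J. f j)"
  shows "real (card J) * exp \<mu> \<le> (\<Sum>j\<in>J. exp (f j))"
proof -
  \<comment> \<open>Jensen's inequality through the tangent line at \<open>\<mu>\<close>.\<close>
  have "exp \<mu> * real (card J) \<le> exp \<mu> * (\<Sum>j\<in>J. 1 + (f j - \<mu>))"
    using assms by (intro mult_left_mono) (simp_all add: sum.distrib sum_subtractf)
  also have "\<dots> \<le> (\<Sum>j\<in>J. exp \<mu> * exp (f j - \<mu>))"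
    unfolding sum_distrib_left by (intro sum_mono mult_left_mono exp_ge_add_one_self) simp
  also have "\<dots> = (\<Sum>j\<in>J. exp (f j))"
    by (simp add: exp_add[symmetric])
  finally show ?thesis
    by (simp add: mult.commute)
qed

lemma ex_shift_prescribed_prime_factors:
  fixes A :: "nat \<Rightarrow> nat set" and K :: nat
  assumes "disjoint_family A" "\<And>j. finite (A j)" and A: "\<And>j p. p \<in> A j \<Longrightarrow> prime p \<and> K < p"
  shows "\<exists>R a. (\<forall>j\<in>{1..K}. prime_factors (a + j) \<inter> prime_factors R = A j) \<and>
    (\<Sum>j = 1..K. new_prime_sum R (a + j)) \<le> 2 * real K"
proof -
  define R where "R = \<Prod>(\<Union>j\<in>{1..K}. A j)"
  have "R > 0"
    unfolding R_def using A by (intro prod_pos) (auto simp: prime_gt_0_nat)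
  have R_factors: "prime_factors R = (\<Union>j\<in>{1..K}. A j)"
    unfolding R_def using assms(2) A
    by (subst prime_factors_prod) (force simp: prime_factorization_prime)+
  have "disjoint_family_on A {1..K}"
    using assms(1) by (rule disjoint_family_on_mono[rotated]) simp
  then obtain x where x: "\<And>j p. j \<in> {1..K} \<Longrightarrow> p \<in> A j \<Longrightarrow> p dvd x + j"
    using ex_dvd_shifts[of "{1..K}" A] assms(2) A by blast
  obtain t where t: "(\<Sum>j = 1..K. new_prime_sum R (x + t * R + j)) \<le> 2 * real K"
    using ex_progression_new_prime_sum_le[OF \<open>R > 0\<close>] by blast
  have "p dvd x + t * R + j" if "j \<in> {1..K}" "p \<in> A j" for j p
  proof -
    have "p dvd R"
      using that R_factors by (auto simp: in_prime_factors_iff)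
    then have "p dvd (x + j) + t * R"
      using x[OF that] by (simp only: dvd_add dvd_mult)
    then show ?thesis
      by (simp add: add_ac)
  qed
  then have "prime_factors (x + t * R + j) \<inter> prime_factors R = A j" if "j \<in> {1..K}" for j
    unfolding R_factors using that A by (intro prime_factors_shift_Int) auto
  with t show ?thesis
    by blast
qed

lemma has_heavy_block_totient_ratio:
  assumes "0 < \<epsilon>" "\<epsilon> \<le> 1"
  shows "has_heavy_block totient_ratio \<epsilon>"
proof -
  obtain K :: nat where K: "2 * exp 4 / \<epsilon> \<le> real K"
    using real_arch_simple by blast
  obtain A :: "nat \<Rightarrow> nat set" where A: "disjoint_family A" "\<And>j. finite (A j)"
    "\<And>j p. p \<in> A j \<Longrightarrow> prime p \<and> K < p" "\<And>j. euler_prod (A j) \<in> {\<epsilon> / 2..\<epsilon>}"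
    using ex_disjoint_prime_sets[OF assms, of K] by blast
  obtain R a where common: "\<forall>j\<in>{1..K}. prime_factors (a + j) \<inter> prime_factors R = A j"
    and new: "(\<Sum>j = 1..K. new_prime_sum R (a + j)) \<le> 2 * real K"
    using ex_shift_prescribed_prime_factors[of A K, OF A(1,2)] A(3) by metis
  have "totient_ratio (a + j) \<le> \<epsilon>" if "j \<in> {1..K}" for j
  proof -
    have "totient_ratio (a + j) \<le> euler_prod (A j)"
      using that common prime_factors_subset_atLeast_2[of "a + j"]
      by (auto simp: totient_ratio_eq_euler_prod intro!: euler_prod_antimono)
    then show ?thesis
      using A(4)[of j] by simp
  qed
  moreover have "1 \<le> (\<Sum>j = 1..K. totient_ratio (a + j))"
  proof -
    let ?E = "\<lambda>j. new_prime_sum R (a + j)"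
    have mean: "real (card {1..K}) * (- 4) \<le> (\<Sum>j = 1..K. - 2 * ?E j)"
      using new unfolding sum_distrib_left[symmetric] by simp
    have "1 \<le> \<epsilon> / 2 * (real (card {1..K}) * exp (- 4))"
      using K \<open>0 < \<epsilon>\<close> by (simp add: exp_minus field_simps)
    also have "\<dots> \<le> \<epsilon> / 2 * (\<Sum>j = 1..K. exp (- 2 * ?E j))"
      using mean \<open>0 < \<epsilon>\<close> by (intro mult_left_mono card_mult_exp_le_sum_exp) auto
    also have "\<dots> \<le> (\<Sum>j = 1..K. euler_prod (A j) * exp (- 2 * ?E j))"
      unfolding sum_distrib_left using A(4) by (intro sum_mono mult_right_mono) auto
    also have "\<dots> \<le> (\<Sum>j = 1..K. totient_ratio (a + j))"
    proof (rule sum_mono)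
      fix j assume "j \<in> {1..K}"
      then show "euler_prod (A j) * exp (- 2 * ?E j) \<le> totient_ratio (a + j)"
        using totient_ratio_ge_new_prime_sum[of "a + j" R] common by simp
    qed
    finally show ?thesis .
  qed
  ultimately show ?thesis
    unfolding has_heavy_block_def by blast
qed

lemma nat_floor_powr_Ints:
  fixes c :: real
  assumes "c > 0" "c \<in> \<int>"
  shows "nat \<lfloor>real m powr c\<rfloor> = m ^ nat \<lfloor>c\<rfloor>"
proof -
  have "real (nat \<lfloor>c\<rfloor>) = c"
    using assms by (auto elim: Ints_cases)
  then have "real m powr c = real (m ^ nat \<lfloor>c\<rfloor>)"
    using assms(1) by (cases "m = 0") (auto simp: powr_realpow[symmetric])
  then show ?thesis
    by (simp only: floor_of_nat nat_int)
qed

section \<open>Density of the partial sums\<close>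

theorem theorem2:
  fixes c :: real
  assumes "c > 1"
  shows "dense_mod_1 (totient_ratio_sum c)"
proof -
  let ?w = "\<lambda>m. totient_ratio (nat \<lfloor>real m powr c\<rfloor>)"
  have "has_heavy_block ?w \<epsilon>" if "0 < \<epsilon>" "\<epsilon> \<le> 1" for \<epsilon>
  proof (cases "c \<in> \<int>")
    case True
    then have "?w = totient_ratio"
      using assms by (simp add: nat_floor_powr_Ints totient_ratio_power)
    then show ?thesis
      using has_heavy_block_totient_ratio[OF that] by simp
  next
    case False
    then show ?thesis
      using assms that by (intro has_heavy_block_totient_ratio_powr) auto
  qed
  then have "dense_mod_1 (\<lambda>n. \<Sum>m = 1..n. ?w m)"
    by (rule dense_mod_1_sum_if_heavy_blocks)
  moreover have "totient_ratio_sum c = (\<lambda>n. \<Sum>m = 1..n. ?w m)"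
    by (simp add: totient_ratio_sum_def totient_ratio_def fun_eq_iff)
  ultimately show ?thesis
    by simp
qed

end
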